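(* Let $\phi_1,\dots,\phi_n\in\mathbb{C}^m$. The set $\{\phi_i\}$ is geometrically uniform if and only if there exist a finite abelian group $Q=\mathbb{Z}_{n_1}\times\cdots\times\mathbb{Z}_{n_p}$ with $\prod_t n_t=n$ and a bijective indexing $\{\phi_i\}=\{\phi(q)\}_{q\in Q}$ such that the Gram matrix $G=[\langle\phi(q'),\phi(q)\rangle]_{q',q\in Q}$ is diagonalized by the Fourier transform matrix $\mathcal{F}$ over $Q$, i.e. $G=\mathcal{F}D\mathcal{F}^*$ for some diagonal matrix $D$. Moreover, in this case the vectors form a geometrically uniform frame for $\mathbb{C}^m$ if and only if $G$ has rank $m$.
   Context: Inner product $\langle x,y\rangle=x^*y$. A set $\{\phi_i\}_{i=1}^n$ is geometrically uniform (GU) if $\phi_i=U_i\phi$ for a generating vector $\phi$, where $\{U_1,\dots,U_n\}$ is an abelian group of $n$ distinct unitary $m\times m$ matrices; it is a GU frame if in addition it spans $\mathbb{C}^m$. For $Q=\mathbb{Z}_{n_1}\times\cdots\times\mathbb{Z}_{n_p}$ ($\mathbb{Z}_{n_t}$ the integers mod $n_t$) and $h=(h_1,\dots,h_p),q=(q_1,\dots,q_p)\in Q$, the Fourier kernel is $\langle h,q\rangle=\prod_{t=1}^p e^{-2\pi i h_tq_t/n_t}$, and the Fourier transform matrix over $Q$ is the $n\times n$ unitary matrix $\mathcal{F}=[\tfrac{1}{\sqrt n}\langle h,q\rangle]_{h,q\in Q}$ (rows and columns indexed by $Q$).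
   Formalization: The vectors φ_1,…,φ_n are assumed pairwise distinct; without this the claim fails, e.g. φ_1=φ_2=1 in C^1 has Gram matrix diagonalized by the Fourier matrix over Z_2 and of rank 1, but is not geometrically uniform. *)

theory Defs
  imports "HOL-Analysis.Analysis"
begin

definition inner_c :: "complex^'m \<Rightarrow> complex^'m \<Rightarrow> complex" where
  "inner_c x y = (\<Sum>k\<in>UNIV. cnj (x $ k) * (y $ k))"

definition adjoint_mat :: "complex^'m^'m \<Rightarrow> complex^'m^'m" where
  "adjoint_mat U = (\<chi> i j. cnj (U $ j $ i))"

definition unitary_mat :: "complex^'m^'m \<Rightarrow> bool" where
  "unitary_mat U \<longleftrightarrow> U ** adjoint_mat U = mat 1 \<and> adjoint_mat U ** U = mat 1"

definition abelian_matrix_group :: "(complex^'m^'m) set \<Rightarrow> bool" where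
  "abelian_matrix_group G \<longleftrightarrow>
     mat 1 \<in> G \<and>
     (\<forall>A\<in>G. \<forall>B\<in>G. A ** B \<in> G) \<and>
     (\<forall>A\<in>G. \<exists>B\<in>G. A ** B = mat 1 \<and> B ** A = mat 1) \<and>
     (\<forall>A\<in>G. \<forall>B\<in>G. A ** B = B ** A)"

definition geom_uniform :: "nat \<Rightarrow> (nat \<Rightarrow> complex^'m) \<Rightarrow> bool" where
  "geom_uniform n phis \<longleftrightarrow>
     (\<exists>(psi::complex^'m) (U::nat \<Rightarrow> complex^'m^'m).
        inj_on U {1..n} \<and>
        (\<forall>i\<in>{1..n}. unitary_mat (U i)) \<and>
        abelian_matrix_group (U ` {1..n}) \<and>
        (\<forall>i\<in>{1..n}. phis i = U i *v psi))"

definition spans_Cm :: "nat \<Rightarrow> (nat \<Rightarrow> complex^'m) \<Rightarrow> bool" where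
  "spans_Cm n phis \<longleftrightarrow> (\<forall>x::complex^'m. \<exists>c::nat \<Rightarrow> complex. x = (\<Sum>i\<in>{1..n}. c i *s phis i))"

definition GU_frame :: "nat \<Rightarrow> (nat \<Rightarrow> complex^'m) \<Rightarrow> bool" where
  "GU_frame n phis \<longleftrightarrow> geom_uniform n phis \<and> spans_Cm n phis"

text \<open>Q = Z_{n_1} x ... x Z_{n_p}, elements represented as lists q with 0 \<le> q_t < n_t.\<close>
definition Zgroup :: "nat list \<Rightarrow> nat list set" where
  "Zgroup ns = {q. length q = length ns \<and> (\<forall>t<length ns. q ! t < ns ! t)}"

definition fourier_kernel :: "nat list \<Rightarrow> nat list \<Rightarrow> nat list \<Rightarrow> complex" where
  "fourier_kernel ns h q =
     (\<Prod>t<length ns. exp (- 2 * of_real pi * \<i> * of_nat (h ! t) * of_nat (q ! t) / of_nat (ns ! t)))"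

definition fourier_mat :: "nat list \<Rightarrow> nat list \<Rightarrow> nat list \<Rightarrow> complex" where
  "fourier_mat ns h q = fourier_kernel ns h q / complex_of_real (sqrt (real (prod_list ns)))"

definition gram_Q :: "(nat list \<Rightarrow> nat) \<Rightarrow> (nat \<Rightarrow> complex^'m) \<Rightarrow> nat list \<Rightarrow> nat list \<Rightarrow> complex" where
  "gram_Q idx phis q' q = inner_c (phis (idx q')) (phis (idx q))"

text \<open>G = F D F^* for some diagonal D = diag(d), written entrywise.\<close>
definition diag_by_fourier :: "nat list \<Rightarrow> (nat list \<Rightarrow> nat list \<Rightarrow> complex) \<Rightarrow> bool" where
  "diag_by_fourier ns G \<longleftrightarrow>
     (\<exists>d::nat list \<Rightarrow> complex. \<forall>q'\<in>Zgroup ns. \<forall>q\<in>Zgroup ns.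
        G q' q = (\<Sum>h\<in>Zgroup ns. fourier_mat ns q' h * d h * cnj (fourier_mat ns q h)))"

definition cols_independent :: "'i set \<Rightarrow> ('i \<Rightarrow> 'i \<Rightarrow> complex) \<Rightarrow> 'i set \<Rightarrow> bool" where
  "cols_independent I G S \<longleftrightarrow>
     (\<forall>c::'i \<Rightarrow> complex. (\<forall>i\<in>I. (\<Sum>j\<in>S. G i j * c j) = 0) \<longrightarrow> (\<forall>j\<in>S. c j = 0))"

definition mat_rank :: "'i set \<Rightarrow> ('i \<Rightarrow> 'i \<Rightarrow> complex) \<Rightarrow> nat" where
  "mat_rank I G = Max {card S | S. S \<subseteq> I \<and> cols_independent I G S}"

definition admissible_indexing :: "nat \<Rightarrow> nat list \<Rightarrow> (nat list \<Rightarrow> nat) \<Rightarrow> bool" where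
  "admissible_indexing n ns idx \<longleftrightarrow>
     (\<forall>t<length ns. 1 \<le> ns ! t) \<and> prod_list ns = n \<and> bij_betw idx (Zgroup ns) {1..n}"

end

theory Submission
  imports Defs "HOL-Algebra.Multiplicative_Group" "HOL-Number_Theory.Cong"
begin

text \<open>
  A matrix indexed by \<open>Q\<close> is diagonalized by the Fourier matrix over \<open>Q\<close> exactly when it is
  invariant under simultaneous translation of both indices. A Gram matrix \<open>\<langle>U\<^sub>q' \<phi>, U\<^sub>q \<phi>\<rangle>\<close> of a
  unitary group orbit is invariant, once the group has been written as a product of cyclic groups.
  Conversely, if \<open>G = F D F\<^sup>*\<close>, then the vectors \<open>w\<^sub>h = \<Sum>\<^sub>q F\<^sub>q\<^sub>h \<phi>(q)\<close> are mutually orthogonal, and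
  the operators that multiply \<open>w\<^sub>h\<close> by the conjugate of \<open>\<langle>r, h\<rangle>\<close> and fix the orthogonal complement of
  all \<open>w\<^sub>h\<close> form an abelian group of unitaries that translate \<open>\<phi>(q)\<close> to \<open>\<phi>(q + r)\<close>. The last claim
  holds because a Gram matrix has the same rank as its family of vectors.
\<close>

section \<open>Finite abelian groups as products of cyclic groups\<close>

lemma (in comm_group) ord_mult_coprime:
  assumes x: "x \<in> carrier G" and y: "y \<in> carrier G" and co: "coprime (ord x) (ord y)"
  shows "ord (x \<otimes> y) = ord x * ord y"
proof (rule dvd_antisym)
  show "ord (x \<otimes> y) dvd ord x * ord y"
    using x y by (rule abelian_ord_mul_divides)
  \<comment> \<open>The exponent \<open>?k\<close> kills both \<open>u \<otimes> v\<close> and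
    \<open>v\<close>, hence \<open>u\<close>; coprimality then strips the factor
    \<open>ord v\<close> from \<open>?k\<close>.\<close>
  have *: "ord u dvd ord (u \<otimes> v)"
    if u: "u \<in> carrier G" and v: "v \<in> carrier G" and "coprime (ord u) (ord v)" for u v
  proof -
    let ?k = "ord (u \<otimes> v) * ord v"
    have "(u \<otimes> v) [^] ?k = \<one>"
      using u v by (subst pow_eq_id) auto
    moreover have "v [^] ?k = \<one>"
      using v by (subst pow_eq_id) auto
    ultimately have "u [^] ?k = \<one>"
      using u v by (simp add: pow_mult_distrib m_comm)
    then have "ord u dvd ?k"
      using u by (simp add: pow_eq_id)
    then show ?thesis
      using that(3) by (simp add: coprime_dvd_mult_left_iff)
  qed
  have "ord x dvd ord (x \<otimes> y)"
    using * x y co by blast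
  moreover have "ord y dvd ord (x \<otimes> y)"
    using *[OF y x] co x y by (simp add: coprime_commute m_comm)
  ultimately show "ord x * ord y dvd ord (x \<otimes> y)"
    using co by (rule divides_mult)
qed

text \<open>An element \<open>a\<close> of maximal order works. If a prime \<open>p\<close> occurred
  to a higher power in \<open>ord x\<close> than in \<open>ord a\<close>, the part of
  \<open>a\<close> of order prime to \<open>p\<close> times the \<open>p\<close>-part of
  \<open>x\<close> would have coprime factor orders, and its order would exceed
  \<open>ord a\<close>.\<close>

lemma (in comm_group) exists_ord_eq_exponent:
  assumes fin: "finite (carrier G)"
  shows "\<exists>a\<in>carrier G. \<forall>x\<in>carrier G. ord x dvd ord a"
proof -
  have "\<exists>a\<in>carrier G. \<forall>x\<in>carrier G. ord x \<le> ord a"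
  proof -
    have ne: "ord ` carrier G \<noteq> {}" "finite (ord ` carrier G)"
      using fin by auto
    then have "Max (ord ` carrier G) \<in> ord ` carrier G"
      using Max_in by blast
    then obtain a where "a \<in> carrier G" "ord a = Max (ord ` carrier G)"
      by force
    then show ?thesis
      using ne by (metis Max_ge image_eqI)
  qed
  then obtain a where a: "a \<in> carrier G" and mx: "\<And>x. x \<in> carrier G \<Longrightarrow> ord x \<le> ord a"
    by blast
  have pos: "ord x > 0" if "x \<in> carrier G" for x
    using ord_ge_1[OF fin that] by simp
  have "ord x dvd ord a" if x: "x \<in> carrier G" for x
  proof (rule ccontr)
    assume "\<not> ord x dvd ord a"
    then obtain p where p: "prime p" and less: "multiplicity p (ord a) < multiplicity p (ord x)"
      using multiplicity_le_imp_dvd[of "ord x" "ord a"] pos[OF x] by (metis not_le not_gr_zero)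
    let ?r = "multiplicity p (ord a)" and ?s = "multiplicity p (ord x)"
    obtain c where c: "ord a = p ^ ?r * c" and pc: "\<not> p dvd c"
      using multiplicity_decompose'[of "ord a" p] pos[OF a] p
      by (metis not_prime_unit not_gr_zero)
    obtain d where d: "ord x = p ^ ?s * d"
      using multiplicity_dvd by blast
    have p0: "p > 0" using p prime_gt_0_nat by blast
    have d0: "d > 0" using d pos[OF x] by (metis mult_0_right not_gr_zero)
    have c0: "c > 0" using c pos[OF a] by (metis mult_0_right not_gr_zero)
    have "ord (a [^] (p ^ ?r)) = c"
      using ord_pow[OF a, of "p ^ ?r"] c p0 by (metis dvd_triv_left nonzero_mult_div_cancel_left not_gr_zero power_not_zero)
    moreover have "ord (x [^] d) = p ^ ?s"
      using ord_pow[OF x, of d] d d0 by (metis dvd_triv_right nonzero_mult_div_cancel_right not_gr_zero)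
    moreover have "coprime c (p ^ ?s)"
      using p pc by (meson coprime_commute coprime_power_right_iff prime_imp_coprime_nat)
    ultimately have "ord (a [^] (p ^ ?r) \<otimes> x [^] d) = c * p ^ ?s"
      using a x by (simp add: ord_mult_coprime)
    moreover have "p ^ ?r * c < c * p ^ ?s"
      using less c0 prime_gt_1_nat[OF p] by (simp add: mult.commute)
    ultimately show False
      using mx[of "a [^] (p ^ ?r) \<otimes> x [^] d"] a x c by simp
  qed
  with a show ?thesis by blast
qed

section \<open>Splitting off a cyclic subgroup of maximal order\<close>

lemma (in group) finite_submonoid_subgroup:
  assumes fin: "finite (carrier G)" and sub: "H \<subseteq> carrier G" and one: "\<one> \<in> H"
    and mult: "\<And>x y. x \<in> H \<Longrightarrow> y \<in> H \<Longrightarrow> x \<otimes> y \<in> H"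
  shows "subgroup H G"
proof
  fix x assume x: "x \<in> H"
  have pow: "x [^] (k::nat) \<in> H" for k
    by (induction k) (use x one mult in auto)
  have xc: "x \<in> carrier G" using x sub by blast
  \<comment> \<open>In a finite group \<open>ord x\<close> is at least 1, so the inverse of
    \<open>x\<close> is the natural power with exponent \<open>ord x - 1\<close>.\<close>
  have "x [^] (ord x - 1) \<otimes> x = x [^] (Suc (ord x - 1))"
    by simp
  also have "\<dots> = \<one>"
    using ord_ge_1[OF fin xc] xc by simp
  finally have "inv x = x [^] (ord x - 1)"
    using xc by (metis inv_equality nat_pow_closed)
  then show "inv x \<in> H" using pow by simp
qed (use assms in auto)

lemma (in subgroup) nat_pow_mem:
  assumes "group G" and "x \<in> H"
  shows "x [^] (k::nat) \<in> H"
proof -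
  interpret group G by fact
  show ?thesis by (induction k) (use assms in auto)
qed

text \<open>
  The complement is a maximal subgroup \<open>K\<close> meeting \<open>\<langle>a\<rangle>\<close> trivially. If \<open>y \<notin> \<langle>a\<rangle> K\<close> but
  \<open>y\<^sup>p \<in> \<langle>a\<rangle> K\<close> for a prime \<open>p\<close>, then dividing \<open>y\<close> by a suitable power of \<open>a\<close> yields \<open>z\<close> with
  \<open>z\<^sup>p \<in> K\<close>, and adjoining \<open>z\<close> to \<open>K\<close> contradicts maximality.
\<close>

lemma (in comm_group) exists_cyclic_direct_factor:
  assumes fin: "finite (carrier G)"
    and a: "a \<in> carrier G" and ex: "\<And>x. x \<in> carrier G \<Longrightarrow> ord x dvd ord a"
  shows "\<exists>K. subgroup K G \<and> (\<forall>i::nat. a [^] i \<in> K \<longrightarrow> a [^] i = \<one>) \<and>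
           (\<forall>x\<in>carrier G. \<exists>(i::nat). \<exists>k\<in>K. x = a [^] i \<otimes> k)"
proof -
  define P where "P K \<longleftrightarrow> subgroup K G \<and> (\<forall>i::nat. a [^] i \<in> K \<longrightarrow> a [^] i = \<one>)" for K
  have "P {\<one>}"
    unfolding P_def using triv_subgroup by auto
  moreover have "\<forall>K. P K \<longrightarrow> card K < Suc (card (carrier G))"
    unfolding P_def using fin by (metis card_mono less_Suc_eq_le subgroup.subset)
  ultimately obtain K where K: "P K" and Kmax: "\<And>K'. P K' \<Longrightarrow> card K' \<le> card K"
    using ex_has_greatest_nat[of P "{\<one>}" card] by blast
  then interpret K: subgroup K G
    unfolding P_def by blast
  have Ka: "a [^] i = \<one>" if "a [^] i \<in> K" for i :: nat
    using K that unfolding P_def by blast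
  have Kpow: "k [^] i \<in> K" if "k \<in> K" for k and i :: nat
    using K.nat_pow_mem[OF is_group that] .
  let ?e = "ord a"
  have e0: "?e > 0" using ord_ge_1[OF fin a] by simp
  have xe: "x [^] ?e = \<one>" if "x \<in> carrier G" for x
    using ex[OF that] that by (simp add: pow_eq_id)
  \<comment> \<open>\<open>A\<close> is the subgroup generated by \<open>a\<close> and
    \<open>K\<close>; the goal is that it exhausts the group.\<close>
  define A where "A = {a [^] (i::nat) \<otimes> k | i k. k \<in> K}"
  have Asub: "A \<subseteq> carrier G" unfolding A_def using a by auto
  have AI: "a [^] i \<otimes> k \<in> A" if "k \<in> K" for i :: nat and k
    unfolding A_def using that by blast
  have KA: "K \<subseteq> A" using AI[of _ 0] by (auto simp: subset_iff)
  have aA: "a [^] i \<in> A" for i :: nat using AI[of \<one> i] a by simp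
  interpret A: subgroup A G
  proof (rule finite_submonoid_subgroup[OF fin Asub])
    show "\<one> \<in> A" using KA by auto
    fix x y assume "x \<in> A" "y \<in> A"
    then obtain i j :: nat and k l where *: "k \<in> K" "l \<in> K" "x = a [^] i \<otimes> k" "y = a [^] j \<otimes> l"
      unfolding A_def by blast
    then have "x \<otimes> y = a [^] (i + j) \<otimes> (k \<otimes> l)"
      using a by (simp add: nat_pow_mult[symmetric] m_ac)
    then show "x \<otimes> y \<in> A" using * AI by simp
  qed
  have Apow: "x [^] i \<in> A" if "x \<in> A" for x and i :: nat
    using A.nat_pow_mem[OF is_group that] .
  \<comment> \<open>Bezout writes \<open>y\<close> as a product of powers of \<open>y [^] p\<close>
    and \<open>y [^] i\<close>, one of them inverted.\<close>
  have unit_pow: "y \<in> A"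
    if y: "y \<in> carrier G" and co: "coprime i (p::nat)" and p: "y [^] p \<in> A" and i: "y [^] i \<in> A"
      and i0: "i > 0" for y and i p :: nat
  proof -
    obtain u v where uv: "i * u = p * v + 1"
      using bezout_nat[of i p] i0 co by auto
    have "y [^] (i * u) = (y [^] p) [^] v \<otimes> y"
      using y by (simp add: uv nat_pow_pow)
    then have "y = inv ((y [^] p) [^] v) \<otimes> (y [^] i) [^] u"
      using y by (simp add: nat_pow_pow m_assoc[symmetric])
    moreover have "inv ((y [^] p) [^] v) \<otimes> (y [^] i) [^] u \<in> A"
      using p i Apow by simp
    ultimately show ?thesis by simp
  qed
  have "x \<in> A" if x: "x \<in> carrier G" for x
  proof (rule ccontr)
    assume xA: "x \<notin> A"
    \<comment> \<open>\<open>n\<close> is the order of \<open>x\<close> modulo \<open>A\<close>,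
      which exists because \<open>x [^] ?e\<close> is trivial.\<close>
    define n where "n = (LEAST n. n > 0 \<and> x [^] (n::nat) \<in> A)"
    have "?e > 0 \<and> x [^] ?e \<in> A" using e0 xe[OF x] by simp
    then have n: "n > 0" "x [^] n \<in> A"
      unfolding n_def by (metis (mono_tags, lifting) LeastI)+
    have nleast: "x [^] m \<notin> A" if "m > 0" "m < n" for m :: nat
      using that not_less_Least unfolding n_def by blast
    have "n \<noteq> 1" using n xA x by auto
    then obtain p where p: "prime p" "p dvd n"
      using prime_factor_nat by blast
    then obtain m where m: "n = p * m" by blast
    \<comment> \<open>For a prime \<open>p\<close> dividing \<open>n\<close>, this \<open>y\<close>
      has order exactly \<open>p\<close> modulo \<open>A\<close>.\<close>
    define y where "y = x [^] m"
    have yc: "y \<in> carrier G" using x by (simp add: y_def)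
    have p1: "p > 1" using p prime_gt_1_nat by blast
    have yA: "y \<notin> A"
      unfolding y_def using nleast[of m] m n p1 by (cases "m = 0") auto
    have ypA: "y [^] p \<in> A"
      using n x m by (simp add: y_def nat_pow_pow mult.commute)
    \<comment> \<open>Since \<open>y [^] ?e\<close> is trivial, an exponent coprime to
      \<open>p\<close> would put \<open>y\<close> into \<open>A\<close>.\<close>
    have pe: "p dvd ?e"
    proof (rule ccontr)
      assume "\<not> p dvd ?e"
      then have "coprime ?e p"
        using p by (metis coprime_commute prime_imp_coprime_nat)
      then show False
        using unit_pow[OF yc _ ypA _ e0] xe[OF yc] yA by simp
    qed
    then obtain e' where e': "?e = p * e'" by blast
    obtain j :: nat and k where k: "k \<in> K" and jk: "y [^] p = a [^] j \<otimes> k"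
      using ypA unfolding A_def by blast
    \<comment> \<open>The power \<open>e'\<close> trivializes \<open>y [^] p\<close>, so
      \<open>a [^] (j * e')\<close> lies in \<open>K\<close> and is trivial. Hence
      \<open>p * e'\<close> divides \<open>j * e'\<close>, which makes \<open>p\<close> divide
      \<open>j\<close>.\<close>
    have "\<one> = (y [^] p) [^] e'"
      using xe[OF yc] yc e' by (simp add: nat_pow_pow)
    also have "\<dots> = a [^] (j * e') \<otimes> k [^] e'"
      using a k by (simp add: jk pow_mult_distrib m_comm nat_pow_pow)
    finally have "a [^] (j * e') = inv (k [^] e')"
      using a k by (metis inv_equality K.mem_carrier nat_pow_closed)
    then have "a [^] (j * e') = \<one>"
      using Ka[of "j * e'"] Kpow[OF k] by simp
    then have "p * e' dvd j * e'"
      using a e' by (simp add: pow_eq_id)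
    then have "p dvd j" using e0 e' by simp
    then obtain j' where j': "j = j' * p" by (metis dvd_def mult.commute)
    \<comment> \<open>As \<open>a [^] j'\<close> is a \<open>p\<close>-th root of
      \<open>a [^] j\<close>, dividing it off leaves \<open>z [^] p = k\<close>.\<close>
    define z where "z = inv (a [^] j') \<otimes> y"
    have zc: "z \<in> carrier G" using a yc by (simp add: z_def)
    have y_z: "y = a [^] j' \<otimes> z" 
      using a yc by (simp add: z_def m_assoc[symmetric])
    have zA: "z \<notin> A"
      using yA y_z aA[of j'] by auto
    have "a [^] j \<otimes> z [^] p = a [^] j \<otimes> k"
      using jk a zc by (simp add: y_z j' pow_mult_distrib m_comm nat_pow_pow)
    then have zp: "z [^] p \<in> K" using a k zc by simp
    define L where "L = {k \<otimes> z [^] (i::nat) | i k. k \<in> K}"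
    have LI: "k \<otimes> z [^] i \<in> L" if "k \<in> K" for i :: nat and k
      unfolding L_def using that by blast
    have L: "subgroup L G"
    proof (rule finite_submonoid_subgroup[OF fin])
      show "L \<subseteq> carrier G" unfolding L_def using zc by auto
      show "\<one> \<in> L" using LI[of \<one> 0] by simp
      fix x y assume "x \<in> L" "y \<in> L"
      then obtain i j :: nat and k l where *: "k \<in> K" "l \<in> K" "x = k \<otimes> z [^] i" "y = l \<otimes> z [^] j"
        unfolding L_def by blast
      then have "x \<otimes> y = (k \<otimes> l) \<otimes> z [^] (i + j)"
        using zc by (simp add: nat_pow_mult[symmetric] m_ac)
      then show "x \<otimes> y \<in> L" using * LI by simp
    qed
    have "P L"
      unfolding P_def
    proof (intro conjI allI impI L)
      fix r :: nat assume "a [^] r \<in> L"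
      then obtain i :: nat and l where l: "l \<in> K" and eq: "a [^] r = l \<otimes> z [^] i"
        unfolding L_def by blast
      \<comment> \<open>If \<open>p\<close> divides \<open>i\<close>, then \<open>z [^] i\<close>
        lies in \<open>K\<close>. Otherwise the coprime powers \<open>z [^] i\<close> and
        \<open>z [^] p\<close> both lie in \<open>A\<close> and force \<open>z\<close> into
        \<open>A\<close>, a contradiction.\<close>
      show "a [^] r = \<one>"
      proof (cases "p dvd i")
        case True
        then obtain i' where "i = p * i'" by blast
        then have "z [^] i = (z [^] p) [^] i'"
          using zc by (simp add: nat_pow_pow)
        then show ?thesis
          using Ka[of r] eq l Kpow[OF zp] by simp
      next
        case False
        then have co: "coprime i p"
          using p by (metis coprime_commute prime_imp_coprime_nat)
        have "i > 0" using False by (cases i) auto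
        have "z [^] i = inv l \<otimes> a [^] r"
          using eq l zc by (simp add: m_assoc[symmetric])
        also have "\<dots> \<in> A" using l KA aA by auto
        finally show ?thesis
          using unit_pow[OF zc co] zp KA \<open>i > 0\<close> zA by auto
      qed
    qed
    moreover have "K \<subset> L"
    proof
      show "K \<subseteq> L" using LI[of _ 0] by (auto simp: subset_iff)
      have "z \<in> L" using LI[of \<one> 1] zc by simp
      then show "K \<noteq> L" using zA KA by auto
    qed
    moreover have "finite L"
      using L fin by (meson finite_subset subgroup.subset)
    ultimately show False
      using Kmax[of L] psubset_card_mono[of L K] by simp
  qed
  then show ?thesis
    using K unfolding P_def A_def by blast
qed

section \<open>Arithmetic in a product of cyclic groups\<close>

fun zadd :: "nat list \<Rightarrow> nat list \<Rightarrow> nat list \<Rightarrow> nat list" where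
  "zadd (n # ns) (x # q) (y # r) = ((x + y) mod n) # zadd ns q r"
| "zadd _ _ _ = []"

lemma Zgroup_Nil: "Zgroup [] = {[]}"
  by (auto simp: Zgroup_def)

lemma Cons_in_Zgroup_iff: "x # q \<in> Zgroup (n # ns) \<longleftrightarrow> x < n \<and> q \<in> Zgroup ns"
  by (auto simp: Zgroup_def nth_Cons split: nat.splits)

lemma Zgroup_Cons: "Zgroup (n # ns) = (\<lambda>(x, q). x # q) ` ({..<n} \<times> Zgroup ns)"
proof (intro Set.set_eqI iffI)
  fix r assume r: "r \<in> Zgroup (n # ns)"
  then obtain x q where "r = x # q"
    by (cases r) (auto simp: Zgroup_def)
  with r show "r \<in> (\<lambda>(x, q). x # q) ` ({..<n} \<times> Zgroup ns)"
    by (auto simp: Cons_in_Zgroup_iff)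
qed (auto simp: Cons_in_Zgroup_iff)

lemma Zgroup_ConsE:
  assumes "r \<in> Zgroup (n # ns)"
  obtains x q where "r = x # q" "x < n" "q \<in> Zgroup ns"
  using assms by (auto simp: Zgroup_Cons)

lemma inj_on_Cons_pair: "inj_on (\<lambda>(x, q). x # q) A"
  by (auto simp: inj_on_def)

lemma finite_Zgroup: "finite (Zgroup ns)"
  by (induction ns) (auto simp: Zgroup_Nil Zgroup_Cons)

lemma card_Zgroup: "card (Zgroup ns) = prod_list ns"
  by (induction ns) (auto simp: Zgroup_Nil Zgroup_Cons card_image inj_on_Cons_pair card_cartesian_product)

lemma zadd_closed: "q \<in> Zgroup ns \<Longrightarrow> r \<in> Zgroup ns \<Longrightarrow> zadd ns q r \<in> Zgroup ns"
  by (induction ns arbitrary: q r) (auto simp: Zgroup_Nil Cons_in_Zgroup_iff elim!: Zgroup_ConsE)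

text \<open>Lists of any length are allowed, since the catch-all clause of \<open>zadd\<close> cuts
  off symmetrically in both lists.\<close>

lemma zadd_commute: "zadd ns q r = zadd ns r q"
  by (induction ns q r rule: zadd.induct) (auto simp: add.commute)

lemma zero_in_Zgroup:
  "\<forall>t<length ns. 1 \<le> ns ! t \<Longrightarrow> replicate (length ns) 0 \<in> Zgroup ns"
  by (auto simp: Zgroup_def)

lemma zadd_zero: "q \<in> Zgroup ns \<Longrightarrow> zadd ns q (replicate (length ns) 0) = q"
  by (induction ns arbitrary: q) (auto simp: Zgroup_Nil elim!: Zgroup_ConsE)

lemma inj_on_zadd: "q \<in> Zgroup ns \<Longrightarrow> inj_on (zadd ns q) (Zgroup ns)"
proof (induction ns arbitrary: q)
  case (Cons n ns)
  from Cons.prems obtain x q' where q: "q = x # q'" "q' \<in> Zgroup ns"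
    by (elim Zgroup_ConsE)
  show ?case
  proof (rule inj_onI)
    fix r s assume "r \<in> Zgroup (n # ns)" "s \<in> Zgroup (n # ns)" and eq: "zadd (n # ns) q r = zadd (n # ns) q s"
    then obtain y r' z s' where *: "r = y # r'" "y < n" "r' \<in> Zgroup ns" "s = z # s'" "z < n" "s' \<in> Zgroup ns"
      by (elim Zgroup_ConsE)
    have "[x + y = x + z] (mod n)" using eq * q by (simp add: cong_def)
    then have "y = z"
      using * by (simp only: cong_add_lcancel_nat) (simp add: cong_def)
    moreover have "r' = s'"
      using inj_onD[OF Cons.IH[OF q(2)]] eq * q by simp
    ultimately show "r = s" using * by simp
  qed
qed (auto simp: Zgroup_Nil)

text \<open>An injective self-map of a finite set is onto. This supplies inverses in
  \<open>Q\<close> and reindexing of sums by translation.\<close>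

lemma bij_betw_zadd: "q \<in> Zgroup ns \<Longrightarrow> bij_betw (zadd ns q) (Zgroup ns) (Zgroup ns)"
  using endo_inj_surj[OF finite_Zgroup _ inj_on_zadd] zadd_closed inj_on_zadd
  by (auto simp: bij_betw_def image_subset_iff)

lemma zadd_inverse:
  assumes "\<forall>t<length ns. 1 \<le> ns ! t" "q \<in> Zgroup ns"
  shows "\<exists>r\<in>Zgroup ns. zadd ns q r = replicate (length ns) 0"
  using bij_betw_zadd[OF assms(2)] zero_in_Zgroup[OF assms(1)]
  by (metis bij_betw_iff_bijections)

text \<open>Induction on the group order: an element \<open>a\<close> whose order is the exponent
  has a complement \<open>K\<close>, and the isomorphism for \<open>K\<close> is extended by a
  leading coordinate holding the exponent of \<open>a\<close>.\<close>

theorem finite_abelian_group_iso_Zgroup: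
  assumes "comm_group G" "finite (carrier G)"
  shows "\<exists>ns f. (\<forall>t<length ns. 1 \<le> ns ! t) \<and> bij_betw f (Zgroup ns) (carrier G) \<and>
           (\<forall>q\<in>Zgroup ns. \<forall>r\<in>Zgroup ns. f (zadd ns q r) = f q \<otimes>\<^bsub>G\<^esub> f r)"
  using assms
proof (induction "card (carrier G)" arbitrary: G rule: less_induct)
  case less
  interpret comm_group G by fact
  note fin = less.prems(2)
  show ?case
  proof (cases "carrier G = {\<one>\<^bsub>G\<^esub>}")
    case True
    \<comment> \<open>The trivial group is the empty product of cyclic groups.\<close>
    then have "bij_betw (\<lambda>_. \<one>\<^bsub>G\<^esub>) (Zgroup []) (carrier G)"
      by (simp add: Zgroup_Nil bij_betw_def)
    then show ?thesis
      by (intro exI[of _ "[]"] exI[of _ "\<lambda>_. \<one>\<^bsub>G\<^esub>"]) auto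
  next
    case False
    obtain a where a: "a \<in> carrier G" and ex: "\<And>x. x \<in> carrier G \<Longrightarrow> ord x dvd ord a"
      using exists_ord_eq_exponent[OF fin] by blast
    obtain K where K: "subgroup K G" and Ka: "\<And>i::nat. a [^]\<^bsub>G\<^esub> i \<in> K \<Longrightarrow> a [^]\<^bsub>G\<^esub> i = \<one>\<^bsub>G\<^esub>"
      and aK: "\<And>x. x \<in> carrier G \<Longrightarrow> \<exists>(i::nat). \<exists>k\<in>K. x = a [^]\<^bsub>G\<^esub> i \<otimes>\<^bsub>G\<^esub> k"
      using exists_cyclic_direct_factor[OF fin a ex] by blast
    interpret K: subgroup K G by fact
    have e0: "ord a > 0" using ord_ge_1[OF fin a] by simp
    \<comment> \<open>If \<open>a\<close> were trivial, all orders would divide 1. Being nontrivial,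
      \<open>a\<close> lies outside \<open>K\<close>, so \<open>K\<close> is small enough for the
      induction.\<close>
    have "a \<noteq> \<one>\<^bsub>G\<^esub>"
    proof
      assume "a = \<one>\<^bsub>G\<^esub>"
      then have "x = \<one>\<^bsub>G\<^esub>" if "x \<in> carrier G" for x
        using ex[OF that] that ord_eq_1[OF that] by simp
      then show False using False by auto
    qed
    then have "a \<notin> K" using Ka[of 1] a by auto
    then have "K \<subset> carrier G" using a K.subset by blast
    then have "card (carrier (G\<lparr>carrier := K\<rparr>)) < card (carrier G)"
      using psubset_card_mono[OF fin] by simp
    moreover have "comm_group (G\<lparr>carrier := K\<rparr>)"
      by (rule group.group_comm_groupI[OF subgroup_imp_group[OF K]]) (simp add: m_comm)
    moreover have "finite (carrier (G\<lparr>carrier := K\<rparr>))"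
      using K.subset fin finite_subset by auto
    ultimately obtain ns f where ns: "\<forall>t<length ns. 1 \<le> ns ! t"
      and bij: "bij_betw f (Zgroup ns) K"
      and hom: "\<And>q r. q \<in> Zgroup ns \<Longrightarrow> r \<in> Zgroup ns \<Longrightarrow> f (zadd ns q r) = f q \<otimes>\<^bsub>G\<^esub> f r"
      using less.hyps[of "G\<lparr>carrier := K\<rparr>"] by auto
    have fK: "f q \<in> K" if "q \<in> Zgroup ns" for q
      using bij that by (auto simp: bij_betw_def)
    define g where "g q = a [^]\<^bsub>G\<^esub> (hd q) \<otimes>\<^bsub>G\<^esub> f (tl q)" for q :: "nat list"
    \<comment> \<open>Powers of \<open>a\<close> do not see the reduction that \<open>zadd\<close>
      performs in the first coordinate.\<close>
    have amod: "a [^]\<^bsub>G\<^esub> (i mod ord a) = a [^]\<^bsub>G\<^esub> i" for i :: nat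
    proof -
      have "a [^]\<^bsub>G\<^esub> i = a [^]\<^bsub>G\<^esub> (ord a * (i div ord a) + i mod ord a)"
        by simp
      also have "\<dots> = (a [^]\<^bsub>G\<^esub> ord a) [^]\<^bsub>G\<^esub> (i div ord a) \<otimes>\<^bsub>G\<^esub> a [^]\<^bsub>G\<^esub> (i mod ord a)"
        using a by (simp only: nat_pow_mult[symmetric] nat_pow_pow nat_pow_closed)
      finally show ?thesis using a by simp
    qed
    have surj: "g ` Zgroup (ord a # ns) = carrier G"
    proof (intro Set.set_eqI iffI)
      fix x assume "x \<in> carrier G"
      then obtain i :: nat and k where k: "k \<in> K" "x = a [^]\<^bsub>G\<^esub> i \<otimes>\<^bsub>G\<^esub> k"
        using aK by blast
      obtain q where q: "q \<in> Zgroup ns" "k = f q"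
        using bij k by (auto simp: bij_betw_def)
      have "x = g ((i mod ord a) # q)"
        using k q by (simp add: g_def amod)
      then show "x \<in> g ` Zgroup (ord a # ns)"
        using q e0 by (auto simp: Cons_in_Zgroup_iff)
    next
      fix x assume "x \<in> g ` Zgroup (ord a # ns)"
      then show "x \<in> carrier G"
        using a fK by (auto simp: g_def elim!: Zgroup_ConsE)
    qed
    have ghom: "g (zadd (ord a # ns) q r) = g q \<otimes>\<^bsub>G\<^esub> g r"
      if "q \<in> Zgroup (ord a # ns)" "r \<in> Zgroup (ord a # ns)" for q r
    proof -
      from that obtain x q' y r' where *: "q = x # q'" "q' \<in> Zgroup ns" "r = y # r'" "r' \<in> Zgroup ns"
        by (elim Zgroup_ConsE)
      then show ?thesis
        using a fK[of q'] fK[of r']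
        by (simp add: g_def amod hom nat_pow_mult[symmetric] m_ac)
    qed
    have inj: "inj_on g (Zgroup (ord a # ns))"
    proof (rule inj_onI)
      fix q r assume "q \<in> Zgroup (ord a # ns)" "r \<in> Zgroup (ord a # ns)" and eq: "g q = g r"
      then obtain x q' y r' where *: "q = x # q'" "x < ord a" "q' \<in> Zgroup ns"
        "r = y # r'" "y < ord a" "r' \<in> Zgroup ns"
        by (elim Zgroup_ConsE)
      have eq': "a [^]\<^bsub>G\<^esub> x \<otimes>\<^bsub>G\<^esub> f q' = a [^]\<^bsub>G\<^esub> y \<otimes>\<^bsub>G\<^esub> f r'"
        using eq * by (simp add: g_def)
      have K': "f q' \<in> K" "f r' \<in> K" using fK * by auto
      \<comment> \<open>\<open>d\<close> represents \<open>x - y\<close> modulo \<open>ord a\<close>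
        without leaving the naturals. The power \<open>a [^] d\<close> lies in \<open>K\<close>, so
        it is trivial and \<open>ord a\<close> divides \<open>d\<close>.\<close>
      define d where "d = x + (ord a - y)"
      have "a [^]\<^bsub>G\<^esub> d \<otimes>\<^bsub>G\<^esub> f q' = a [^]\<^bsub>G\<^esub> (ord a - y) \<otimes>\<^bsub>G\<^esub> (a [^]\<^bsub>G\<^esub> x \<otimes>\<^bsub>G\<^esub> f q')"
        using a K' by (simp add: d_def nat_pow_mult[symmetric] m_ac)
      also have "\<dots> = a [^]\<^bsub>G\<^esub> (ord a - y + y) \<otimes>\<^bsub>G\<^esub> f r'"
        using a K' by (simp add: eq' nat_pow_mult[symmetric] m_ac)
      also have "\<dots> = f r'" using a K' * by simp
      finally have "a [^]\<^bsub>G\<^esub> d = f r' \<otimes>\<^bsub>G\<^esub> inv\<^bsub>G\<^esub> f q'"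
        using a K' by (metis K.mem_carrier inv_solve_right nat_pow_closed)
      then have d1: "a [^]\<^bsub>G\<^esub> d = \<one>\<^bsub>G\<^esub>"
        using Ka[of d] K' by simp
      then have "ord a dvd d" using a by (simp add: pow_eq_id)
      then have "[x + (ord a - y) = y + (ord a - y)] (mod ord a)"
        using * by (simp add: d_def cong_def)
      then have "x = y"
        using * by (simp only: cong_add_rcancel_nat) (simp add: cong_def)
      moreover have "q' = r'"
        using eq' \<open>x = y\<close> a K' bij * by (auto simp: bij_betw_def inj_on_def)
      ultimately show "q = r" using * by simp
    qed
    show ?thesis
    proof (intro exI conjI)
      show "\<forall>t<length (ord a # ns). 1 \<le> (ord a # ns) ! t"
        using ns e0 by (auto simp: nth_Cons split: nat.splits)
      show "bij_betw g (Zgroup (ord a # ns)) (carrier G)"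
        using inj surj by (simp add: bij_betw_def)
      show "\<forall>q\<in>Zgroup (ord a # ns). \<forall>r\<in>Zgroup (ord a # ns).
          g (zadd (ord a # ns) q r) = g q \<otimes>\<^bsub>G\<^esub> g r"
        using ghom by blast
    qed
  qed
qed

section \<open>Fourier matrices\<close>

definition cyclic_kernel :: "nat \<Rightarrow> nat \<Rightarrow> nat \<Rightarrow> complex" where
  "cyclic_kernel n x y = exp (- 2 * of_real pi * \<i> * of_nat x * of_nat y / of_nat n)"

lemma fourier_kernel_Nil: "fourier_kernel [] h q = 1"
  by (simp add: fourier_kernel_def)

lemma fourier_kernel_Cons:
  "fourier_kernel (n # ns) (x # h) (y # q) = cyclic_kernel n x y * fourier_kernel ns h q"
  unfolding fourier_kernel_def cyclic_kernel_def
  by (simp only: length_Cons prod.lessThan_Suc_shift nth_Cons_0 nth_Cons_Suc o_def)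

lemma fourier_kernel_commute: "fourier_kernel ns h q = fourier_kernel ns q h"
  unfolding fourier_kernel_def by (simp add: mult.commute mult.left_commute)

lemma norm_fourier_kernel: "norm (fourier_kernel ns h q) = 1"
  unfolding fourier_kernel_def by (simp add: prod_norm[symmetric])

lemma fourier_kernel_mult_cnj: "fourier_kernel ns h q * cnj (fourier_kernel ns h q) = 1"
  by (simp add: complex_norm_square[symmetric] norm_fourier_kernel)

lemma cyclic_kernel_power: "cyclic_kernel n x y = exp (- 2 * of_real pi * \<i> * of_nat x / of_nat n) ^ y"
  by (simp add: cyclic_kernel_def exp_of_nat_mult[symmetric] mult_ac)

text \<open>Multiples of \<open>n\<close> in the first index contribute whole turns to the
  exponential whose \<open>y\<close>-th power is the kernel.\<close>

lemma cyclic_kernel_mod: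
  assumes "n > 0"
  shows "cyclic_kernel n (x mod n) y = cyclic_kernel n x y"
proof -
  have 1: "exp (- 2 * of_real pi * \<i> * of_nat (n * k) / of_nat n :: complex) = 1" for k
  proof -
    have "- 2 * of_real pi * \<i> * of_nat (n * k) / of_nat n = (2 * of_int (- int k) * of_real pi) * \<i>"
      using assms by (simp add: field_simps)
    then show ?thesis
      using exp_integer_2pi[of "of_int (- int k)"] by simp
  qed
  have "exp (- 2 * of_real pi * \<i> * of_nat x / of_nat n :: complex) =
     exp (- 2 * of_real pi * \<i> * of_nat (x mod n) / of_nat n)"
  proof -
    have "x = n * (x div n) + x mod n" by simp
    then have "- 2 * of_real pi * \<i> * of_nat x / of_nat n =
       - 2 * of_real pi * \<i> * of_nat (n * (x div n)) / of_nat n +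
       - 2 * of_real pi * \<i> * of_nat (x mod n) / (of_nat n :: complex)"
      by (metis (no_types, lifting) add_divide_distrib distrib_left of_nat_add)
    then show ?thesis using 1 by (simp only: exp_add mult_1_left)
  qed
  then show ?thesis by (simp only: cyclic_kernel_power)
qed

lemma cyclic_kernel_add: "cyclic_kernel n (x + y) z = cyclic_kernel n x z * cyclic_kernel n y z"
  by (simp add: cyclic_kernel_def exp_add[symmetric] algebra_simps add_divide_distrib diff_divide_distrib)

text \<open>For fixed \<open>h\<close> the kernel is a character of \<open>Q\<close>: exponents add
  in each coordinate, and periodicity absorbs the reductions made by \<open>zadd\<close>.\<close>

lemma fourier_kernel_zadd:
  "q \<in> Zgroup ns \<Longrightarrow> r \<in> Zgroup ns \<Longrightarrow> h \<in> Zgroup ns \<Longrightarrow>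
    fourier_kernel ns (zadd ns q r) h = fourier_kernel ns q h * fourier_kernel ns r h"
proof (induction ns arbitrary: q r h)
  case (Cons n ns)
  from Cons.prems obtain x q' y r' z h' where
    "q = x # q'" "q' \<in> Zgroup ns" "r = y # r'" "r' \<in> Zgroup ns" "h = z # h'" "h' \<in> Zgroup ns" "z < n"
    by (elim Zgroup_ConsE)
  with Cons.IH show ?case
    by (simp add: fourier_kernel_Cons cyclic_kernel_mod cyclic_kernel_add)
qed (simp add: fourier_kernel_Nil Zgroup_Nil)

text \<open>A geometric sum whose ratio \<open>w\<close> is an \<open>n\<close>-th root of unity
  vanishes unless \<open>w = 1\<close>, and for indices below \<open>n\<close> that means
  \<open>x = y\<close>.\<close>

lemma cyclic_kernel_orthogonal:
  assumes "x < n" "y < n"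
  shows "(\<Sum>z<n. cyclic_kernel n x z * cnj (cyclic_kernel n y z)) = (if x = y then of_nat n else 0)"
proof -
  let ?e = "\<lambda>x. exp (- 2 * of_real pi * \<i> * of_nat x / of_nat n :: complex)"
  define w where "w = ?e x * cnj (?e y)"
  have n0: "n > 0" using assms by simp
  have ne: "cnj (?e y) = exp (2 * of_real pi * \<i> * of_nat y / of_nat n)" for y
    by (simp add: exp_cnj)
  have inv: "?e x = inverse (exp (2 * of_real pi * \<i> * of_nat x / of_nat n))" for x
    by (simp add: exp_minus[symmetric])
  have w1: "w = 1 \<longleftrightarrow> x = y"
  proof -
    have "w = 1 \<longleftrightarrow> exp (2 * of_real pi * \<i> * of_nat y / of_nat n) = exp (2 * of_real pi * \<i> * of_nat x / of_nat n :: complex)"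
      unfolding w_def ne[of y] inv[of x] by (simp add: field_simps)
    also have "\<dots> \<longleftrightarrow> x = y"
      using assms n0 complex_root_unity_eq[of n y x] by (auto simp: cong_def)
    finally show ?thesis .
  qed
  have "?e x ^ n = 1" for x
  proof -
    have "?e x ^ n = cyclic_kernel n n x"
      by (simp add: cyclic_kernel_power exp_of_nat_mult[symmetric] mult_ac)
    also have "\<dots> = cyclic_kernel n (n mod n) x" using cyclic_kernel_mod[OF n0, of n x] by simp
    finally show ?thesis by (simp add: cyclic_kernel_def)
  qed
  then have wn: "w ^ n = 1"
    by (simp add: w_def power_mult_distrib complex_cnj_power[symmetric] del: complex_cnj_power)
  have "(\<Sum>z<n. cyclic_kernel n x z * cnj (cyclic_kernel n y z)) = (\<Sum>z<n. w ^ z)"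
    by (simp add: cyclic_kernel_power w_def power_mult_distrib)
  also have "\<dots> = (if x = y then of_nat n else 0)"
    using w1 wn geometric_sum[of w n] by auto
  finally show ?thesis .
qed

text \<open>The sum over \<open>Q\<close> factors into one cyclic sum per coordinate, so one unequal
  coordinate annihilates it.\<close>

lemma fourier_kernel_orthogonal:
  "q \<in> Zgroup ns \<Longrightarrow> r \<in> Zgroup ns \<Longrightarrow>
    (\<Sum>h\<in>Zgroup ns. fourier_kernel ns q h * cnj (fourier_kernel ns r h)) =
    (if q = r then of_nat (prod_list ns) else 0)"
proof (induction ns arbitrary: q r)
  case (Cons n ns)
  from Cons.prems obtain x q' y r' where
    *: "q = x # q'" "q' \<in> Zgroup ns" "r = y # r'" "r' \<in> Zgroup ns" "x < n" "y < n"
    by (elim Zgroup_ConsE)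
  have "(\<Sum>h\<in>Zgroup (n # ns). fourier_kernel (n # ns) q h * cnj (fourier_kernel (n # ns) r h)) =
    (\<Sum>(z, h)\<in>{..<n} \<times> Zgroup ns. (cyclic_kernel n x z * cnj (cyclic_kernel n y z)) *
       (fourier_kernel ns q' h * cnj (fourier_kernel ns r' h)))"
    unfolding Zgroup_Cons
    by (subst sum.reindex[OF inj_on_Cons_pair])
       (auto intro!: sum.cong simp: * fourier_kernel_Cons mult_ac)
  also have "\<dots> = (\<Sum>z<n. cyclic_kernel n x z * cnj (cyclic_kernel n y z)) *
      (\<Sum>h\<in>Zgroup ns. fourier_kernel ns q' h * cnj (fourier_kernel ns r' h))"
    by (simp add: sum_product sum.cartesian_product)
  also have "\<dots> = (if q = r then of_nat (prod_list (n # ns)) else 0)"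
    using * Cons.IH[of q' r'] by (simp add: cyclic_kernel_orthogonal)
  finally show ?case .
qed (simp add: fourier_kernel_Nil Zgroup_Nil)

section \<open>The normalized Fourier matrix and translation-invariant matrices\<close>

lemma fourier_mat_mult_cnj:
  "fourier_mat ns q h * cnj (fourier_mat ns r h') =
    fourier_kernel ns q h * cnj (fourier_kernel ns r h') / of_nat (prod_list ns)"
proof -
  have "complex_of_real (sqrt (real (prod_list ns))) * complex_of_real (sqrt (real (prod_list ns))) = of_nat (prod_list ns)"
    by (simp add: of_real_mult[symmetric] del: of_real_mult)
  then show ?thesis
    by (simp add: fourier_mat_def)
qed

lemma fourier_mat_orthonormal:
  assumes "q \<in> Zgroup ns" "r \<in> Zgroup ns"
  shows "(\<Sum>h\<in>Zgroup ns. fourier_mat ns q h * cnj (fourier_mat ns r h)) = (if q = r then 1 else 0)"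
proof -
  have "prod_list ns \<noteq> 0"
    using assms finite_Zgroup[of ns] card_Zgroup[of ns] by (metis card_eq_0_iff empty_iff)
  then show ?thesis
    using fourier_kernel_orthogonal[OF assms]
    by (simp add: fourier_mat_mult_cnj sum_divide_distrib[symmetric])
qed

lemma fourier_mat_commute: "fourier_mat ns h q = fourier_mat ns q h"
  by (simp add: fourier_mat_def fourier_kernel_commute)

lemma fourier_mat_zadd:
  "q \<in> Zgroup ns \<Longrightarrow> r \<in> Zgroup ns \<Longrightarrow> h \<in> Zgroup ns \<Longrightarrow>
    fourier_mat ns (zadd ns q r) h = fourier_mat ns q h * fourier_kernel ns r h"
  by (simp add: fourier_mat_def fourier_kernel_zadd)

text \<open>Translating both indices by \<open>r\<close> multiplies the summand at \<open>h\<close>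
  by a kernel value times its conjugate, which is 1. Conversely, an invariant matrix is determined
  by its row at zero.\<close>

theorem diag_by_fourier_iff_translation_invariant:
  assumes "\<forall>t<length ns. 1 \<le> ns ! t"
  shows "diag_by_fourier ns G \<longleftrightarrow>
    (\<forall>q'\<in>Zgroup ns. \<forall>q\<in>Zgroup ns. \<forall>r\<in>Zgroup ns. G (zadd ns q' r) (zadd ns q r) = G q' q)"
    (is "?L \<longleftrightarrow> ?R")
proof
  assume ?L
  then obtain d where d: "\<And>q' q. q' \<in> Zgroup ns \<Longrightarrow> q \<in> Zgroup ns \<Longrightarrow>
      G q' q = (\<Sum>h\<in>Zgroup ns. fourier_mat ns q' h * d h * cnj (fourier_mat ns q h))"
    unfolding diag_by_fourier_def by blast
  show ?R
  proof (intro ballI)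
    fix q' q r assume *: "q' \<in> Zgroup ns" "q \<in> Zgroup ns" "r \<in> Zgroup ns"
    have "fourier_mat ns (zadd ns q' r) h * d h * cnj (fourier_mat ns (zadd ns q r) h) =
        fourier_mat ns q' h * d h * cnj (fourier_mat ns q h)" if "h \<in> Zgroup ns" for h
    proof -
      have "fourier_mat ns (zadd ns q' r) h * d h * cnj (fourier_mat ns (zadd ns q r) h) =
        (fourier_mat ns q' h * d h * cnj (fourier_mat ns q h)) *
        (fourier_kernel ns r h * cnj (fourier_kernel ns r h))"
        using * that by (simp add: fourier_mat_zadd mult_ac)
      then show ?thesis by (simp add: fourier_kernel_mult_cnj)
    qed
    then have "(\<Sum>h\<in>Zgroup ns. fourier_mat ns (zadd ns q' r) h * d h * cnj (fourier_mat ns (zadd ns q r) h)) =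
        (\<Sum>h\<in>Zgroup ns. fourier_mat ns q' h * d h * cnj (fourier_mat ns q h))"
      by (rule sum.cong[OF refl])
    then show "G (zadd ns q' r) (zadd ns q r) = G q' q"
      using * by (simp only: d zadd_closed)
  qed
next
  assume inv: ?R
  let ?Z = "Zgroup ns" and ?o = "replicate (length ns) 0"
  have o: "?o \<in> ?Z" using assms by (rule zero_in_Zgroup)
  \<comment> \<open>The eigenvalues are the Fourier transform of the row at zero.\<close>
  define d where "d h = (\<Sum>r\<in>?Z. G ?o r * fourier_kernel ns r h)" for h
  have "G q' q = (\<Sum>h\<in>?Z. fourier_mat ns q' h * d h * cnj (fourier_mat ns q h))"
    if q': "q' \<in> ?Z" and q: "q \<in> ?Z" for q' q
  proof -
    have "(\<Sum>h\<in>?Z. fourier_mat ns q' h * d h * cnj (fourier_mat ns q h)) =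
      (\<Sum>h\<in>?Z. \<Sum>r\<in>?Z. G ?o r * (fourier_mat ns (zadd ns q' r) h * cnj (fourier_mat ns q h)))"
      unfolding d_def
      by (intro sum.cong refl)
        (simp add: sum_distrib_left sum_distrib_right fourier_mat_zadd q' mult_ac)
    also have "\<dots> = (\<Sum>r\<in>?Z. G ?o r * (\<Sum>h\<in>?Z. fourier_mat ns (zadd ns q' r) h * cnj (fourier_mat ns q h)))"
      by (subst sum.swap) (simp add: sum_distrib_left)
    \<comment> \<open>Translation by \<open>q'\<close> moves the row at zero to the row at
      \<open>q'\<close>, and orthonormality collapses the inner sum.\<close>
    also have "\<dots> = (\<Sum>r\<in>?Z. G q' (zadd ns q' r) * (if zadd ns q' r = q then 1 else 0))"
    proof (intro sum.cong refl)
      fix r assume r: "r \<in> ?Z"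
      have "G ?o r = G (zadd ns ?o q') (zadd ns r q')"
        using inv o r q' by simp
      also have "\<dots> = G q' (zadd ns q' r)"
        using q' by (simp add: zadd_commute[of ns _ q'] zadd_zero)
      finally show "G ?o r * (\<Sum>h\<in>?Z. fourier_mat ns (zadd ns q' r) h * cnj (fourier_mat ns q h)) =
        G q' (zadd ns q' r) * (if zadd ns q' r = q then 1 else 0)"
        using q q' r by (simp add: fourier_mat_orthonormal zadd_closed)
    qed
    also have "\<dots> = (\<Sum>s\<in>?Z. G q' s * (if s = q then 1 else 0))"
      using sum.reindex_bij_betw[OF bij_betw_zadd[OF q'], of "\<lambda>s. G q' s * (if s = q then 1 else 0)"] .
    also have "\<dots> = G q' q"
      using q finite_Zgroup by (simp add: if_distrib cong: if_cong)
    finally show ?thesis by simp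
  qed
  then show ?L unfolding diag_by_fourier_def by blast
qed

section \<open>Unitary matrices with prescribed orthogonal eigenvectors\<close>

lemma inner_c_add_right: "inner_c x (y + z) = inner_c x y + inner_c x z"
  by (simp add: inner_c_def algebra_simps sum.distrib)

lemma inner_c_scale_right: "inner_c x (c *s y) = c * inner_c x y"
  by (simp add: inner_c_def sum_distrib_left mult_ac)

lemma inner_c_sum_right: "inner_c x (\<Sum>i\<in>A. f i) = (\<Sum>i\<in>A. inner_c x (f i))"
  by (simp add: inner_c_def sum_distrib_left sum_component) (rule sum.swap)

lemma inner_c_sum_scale_right: "inner_c x (\<Sum>i\<in>A. c i *s f i) = (\<Sum>i\<in>A. c i * inner_c x (f i))"
  by (simp add: inner_c_sum_right inner_c_scale_right)

lemma inner_c_commute: "inner_c x y = cnj (inner_c y x)"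
  by (simp add: inner_c_def mult.commute)

lemma inner_c_sum_scale_left: "inner_c (\<Sum>i\<in>A. c i *s f i) x = (\<Sum>i\<in>A. cnj (c i) * inner_c (f i) x)"
  by (subst inner_c_commute) (simp add: inner_c_sum_scale_right inner_c_commute[symmetric])

lemma inner_c_zero_left [simp]: "inner_c 0 x = 0"
  by (simp add: inner_c_def)

lemma inner_c_self_eq_0: "inner_c x x = 0 \<longleftrightarrow> x = 0"
proof -
  have "inner_c x x = of_real (\<Sum>k\<in>UNIV. (cmod (x $ k))\<^sup>2)"
    by (simp add: inner_c_def complex_norm_square mult.commute del: of_real_power)
  then have "inner_c x x = 0 \<longleftrightarrow> (\<Sum>k\<in>UNIV. (cmod (x $ k))\<^sup>2) = 0"
    by (metis of_real_eq_0_iff)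
  also have "\<dots> \<longleftrightarrow> x = 0"
    by (simp add: sum_nonneg_eq_0_iff vec_eq_iff)
  finally show ?thesis .
qed

lemma inner_c_adjoint: "inner_c (A *v x) y = inner_c x (adjoint_mat A *v y)"
  unfolding inner_c_def matrix_vector_mult_def adjoint_mat_def
  by (simp add: sum_distrib_left sum_distrib_right mult_ac) (rule sum.swap)

lemma inner_c_unitary:
  assumes "unitary_mat U"
  shows "inner_c (U *v x) (U *v y) = inner_c x y"
  using assms by (simp add: inner_c_adjoint unitary_mat_def matrix_vector_mul_assoc)

text \<open>
  The matrix that multiplies \<open>w h\<close> by \<open>\<alpha> h\<close> and fixes the orthogonal complement of all \<open>w h\<close>.
  Zero vectors \<open>w h\<close> are harmless, because their summand vanishes by \<open>x / 0 = 0\<close>.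
\<close>

definition spectral_mat :: "'i set \<Rightarrow> ('i \<Rightarrow> complex^'m) \<Rightarrow> ('i \<Rightarrow> complex) \<Rightarrow> complex^'m^'m" where
  "spectral_mat H w \<alpha> = (\<chi> i j. (if i = j then 1 else 0) +
     (\<Sum>h\<in>H. (\<alpha> h - 1) * (w h $ i * cnj (w h $ j)) / inner_c (w h) (w h)))"

lemma spectral_mat_mult_vec:
  "spectral_mat H w \<alpha> *v x =
    x + (\<Sum>h\<in>H. ((\<alpha> h - 1) * (inner_c (w h) x / inner_c (w h) (w h))) *s w h)"
proof (rule vec_eq_iff[THEN iffD2], rule allI)
  fix i
  have "(\<Sum>j\<in>UNIV. \<Sum>h\<in>H. (\<alpha> h - 1) * (w h $ i * cnj (w h $ j)) / inner_c (w h) (w h) * x $ j) =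
    (\<Sum>h\<in>H. (\<alpha> h - 1) * (inner_c (w h) x / inner_c (w h) (w h)) * w h $ i)"
    by (subst sum.swap, rule sum.cong)
      (simp_all add: inner_c_def[of _ x] sum_divide_distrib sum_distrib_left sum_distrib_right mult_ac)
  then show "(spectral_mat H w \<alpha> *v x) $ i =
      (x + (\<Sum>h\<in>H. ((\<alpha> h - 1) * (inner_c (w h) x / inner_c (w h) (w h))) *s w h)) $ i"
    by (simp add: spectral_mat_def matrix_vector_mult_def distrib_right sum.distrib sum_distrib_right
        if_distrib[of "\<lambda>c. c * _"] cong: if_cong)
qed

lemma spectral_mat_one: "spectral_mat H w (\<lambda>_. 1) = mat 1"
  by (simp add: spectral_mat_def mat_def)

text \<open>The rank-one terms are self-adjoint because \<open>inner_c x x\<close> is real, so only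
  the eigenvalues get conjugated.\<close>

lemma adjoint_spectral_mat:
  fixes w :: "'i \<Rightarrow> complex^'m"
  shows "adjoint_mat (spectral_mat H w \<alpha>) = spectral_mat H w (\<lambda>h. cnj (\<alpha> h))"
proof -
  have "cnj (inner_c x x) = inner_c x x" for x :: "complex^'m"
    using inner_c_commute[of x x] by simp
  then show ?thesis
    by (simp add: spectral_mat_def adjoint_mat_def vec_eq_iff mult_ac)
qed

lemma spectral_mat_cong: "(\<And>h. h \<in> H \<Longrightarrow> \<alpha> h = \<beta> h) \<Longrightarrow> spectral_mat H w \<alpha> = spectral_mat H w \<beta>"
  by (simp add: spectral_mat_def)

text \<open>Orthogonality leaves only the summand at \<open>h\<close>, so the component along
  \<open>w h\<close> is scaled by \<open>1 + (\<alpha> h - 1)\<close>.\<close>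

lemma inner_c_spectral_mat:
  assumes "finite H" and orth: "\<And>h h'. h \<in> H \<Longrightarrow> h' \<in> H \<Longrightarrow> h \<noteq> h' \<Longrightarrow> inner_c (w h) (w h') = 0"
    and h: "h \<in> H"
  shows "inner_c (w h) (spectral_mat H w \<alpha> *v x) = \<alpha> h * inner_c (w h) x"
proof -
  let ?c = "\<lambda>h'. (\<alpha> h' - 1) * (inner_c (w h') x / inner_c (w h') (w h'))"
  have "(\<Sum>h'\<in>H. ?c h' * inner_c (w h) (w h')) = ?c h * inner_c (w h) (w h)"
    using assms(1) orth[OF h] by (subst sum.remove[OF _ h]) (auto intro!: sum.neutral, metis)
  \<comment> \<open>For \<open>w h = 0\<close> the quotient by zero is 0, and the right side
    vanishes as well.\<close>
  also have "\<dots> = (\<alpha> h - 1) * inner_c (w h) x"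
    by (cases "w h = 0") (auto simp: inner_c_self_eq_0)
  finally show ?thesis
    by (simp add: spectral_mat_mult_vec inner_c_add_right inner_c_sum_scale_right algebra_simps)
qed

text \<open>Along each \<open>w h\<close> the two corrections combine by \<open>(\<beta> h - 1) +
  (\<alpha> h - 1) * \<beta> h = \<alpha> h * \<beta> h - 1\<close>.\<close>

lemma spectral_mat_mult:
  assumes "finite H" and "\<And>h h'. h \<in> H \<Longrightarrow> h' \<in> H \<Longrightarrow> h \<noteq> h' \<Longrightarrow> inner_c (w h) (w h') = 0"
  shows "spectral_mat H w \<alpha> ** spectral_mat H w \<beta> = spectral_mat H w (\<lambda>h. \<alpha> h * \<beta> h)"
proof (rule matrix_eq[THEN iffD2], rule allI)
  fix x
  let ?c = "\<lambda>h. inner_c (w h) x / inner_c (w h) (w h)"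
  have "spectral_mat H w \<alpha> *v (spectral_mat H w \<beta> *v x) =
     spectral_mat H w \<beta> *v x +
       (\<Sum>h\<in>H. ((\<alpha> h - 1) * (inner_c (w h) (spectral_mat H w \<beta> *v x) / inner_c (w h) (w h))) *s w h)"
    by (rule spectral_mat_mult_vec)
  also have "(\<Sum>h\<in>H. ((\<alpha> h - 1) * (inner_c (w h) (spectral_mat H w \<beta> *v x) / inner_c (w h) (w h))) *s w h) =
     (\<Sum>h\<in>H. ((\<alpha> h - 1) * (\<beta> h * ?c h)) *s w h)"
    using assms by (intro sum.cong refl) (simp add: inner_c_spectral_mat)
  also have "spectral_mat H w \<beta> *v x + \<dots> =
      x + (\<Sum>h\<in>H. ((\<beta> h - 1) * ?c h) *s w h + ((\<alpha> h - 1) * (\<beta> h * ?c h)) *s w h)"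
    by (simp add: spectral_mat_mult_vec sum.distrib)
  also have "\<dots> = spectral_mat H w (\<lambda>h. \<alpha> h * \<beta> h) *v x"
    unfolding spectral_mat_mult_vec vec.scale_left_distrib[symmetric]
    by (intro arg_cong2[where f = "(+)"] sum.cong refl arg_cong2[where f = "(*s)"])
      (simp add: algebra_simps add_divide_distrib diff_divide_distrib)
  finally show "spectral_mat H w \<alpha> ** spectral_mat H w \<beta> *v x = spectral_mat H w (\<lambda>h. \<alpha> h * \<beta> h) *v x"
    by (simp add: matrix_vector_mul_assoc)
qed

lemma spectral_mat_eigenvector:
  assumes "finite H" and orth: "\<And>h h'. h \<in> H \<Longrightarrow> h' \<in> H \<Longrightarrow> h \<noteq> h' \<Longrightarrow> inner_c (w h) (w h') = 0"
    and h: "h \<in> H"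
  shows "spectral_mat H w \<alpha> *v w h = \<alpha> h *s w h"
proof -
  have "(\<Sum>h'\<in>H. ((\<alpha> h' - 1) * (inner_c (w h') (w h) / inner_c (w h') (w h'))) *s w h') =
    ((\<alpha> h - 1) * (inner_c (w h) (w h) / inner_c (w h) (w h))) *s w h"
    using assms by (subst sum.remove[OF _ h]) (auto intro!: sum.neutral)
  also have "\<dots> = (\<alpha> h - 1) *s w h"
    by (cases "w h = 0") (auto simp: inner_c_self_eq_0)
  finally show ?thesis
    by (simp add: spectral_mat_mult_vec vec.scale_left_diff_distrib)
qed

section \<open>Geometric uniformity\<close>

text \<open>Labelling the matrices by \<open>Q\<close> through the structure theorem makes
  translation by \<open>r\<close> act on the orbit as the unitary \<open>f r\<close>, which
  preserves inner products.\<close>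

theorem geom_uniform_imp_fourier:
  fixes phis :: "nat \<Rightarrow> complex^'m"
  assumes "geom_uniform n phis"
  shows "\<exists>ns idx. admissible_indexing n ns idx \<and> diag_by_fourier ns (gram_Q idx phis)"
proof -
  from assms obtain psi :: "complex^'m" and U :: "nat \<Rightarrow> complex^'m^'m" where
    inj: "inj_on U {1..n}" and unit: "\<forall>i\<in>{1..n}. unitary_mat (U i)"
    and grp: "abelian_matrix_group (U ` {1..n})" and phi: "\<forall>i\<in>{1..n}. phis i = U i *v psi"
    unfolding geom_uniform_def by blast
  define M where "M = \<lparr>carrier = U ` {1..n}, monoid.mult = (**) :: complex^'m^'m \<Rightarrow> _ \<Rightarrow> _, one = mat 1 :: complex^'m^'m\<rparr>"
  have "comm_group M"
  proof (rule comm_groupI)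
    fix x assume "x \<in> carrier M"
    then show "\<exists>y\<in>carrier M. y \<otimes>\<^bsub>M\<^esub> x = \<one>\<^bsub>M\<^esub>"
      using grp unfolding abelian_matrix_group_def M_def by auto
  qed (use grp in \<open>auto simp: M_def abelian_matrix_group_def matrix_mul_assoc\<close>)
  moreover have "finite (carrier M)" by (simp add: M_def)
  ultimately obtain ns f where ns: "\<forall>t<length ns. 1 \<le> ns ! t"
    and bij: "bij_betw f (Zgroup ns) (U ` {1..n})"
    and hom: "\<And>q r. q \<in> Zgroup ns \<Longrightarrow> r \<in> Zgroup ns \<Longrightarrow> f (zadd ns q r) = f q ** f r"
    using finite_abelian_group_iso_Zgroup[of M] by (auto simp: M_def)
  \<comment> \<open>\<open>idx q\<close> is the position of the matrix \<open>f q\<close> in the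
    enumeration \<open>U\<close>, unique since \<open>U\<close> is injective.\<close>
  define idx where "idx = inv_into {1..n} U \<circ> f"
  have bij_idx: "bij_betw idx (Zgroup ns) {1..n}"
    unfolding idx_def using bij bij_betw_trans bij_betw_inv_into inj inj_on_imp_bij_betw by blast
  have Uidx: "U (idx q) = f q" if "q \<in> Zgroup ns" for q
    using bij_betw_apply[OF bij that] unfolding idx_def comp_def by (rule f_inv_into_f)
  have idx_mem: "idx q \<in> {1..n}" if "q \<in> Zgroup ns" for q
    using bij_idx that by (auto simp: bij_betw_def)
  have phif: "phis (idx q) = f q *v psi" if "q \<in> Zgroup ns" for q
    using phi idx_mem[OF that] Uidx[OF that] by auto
  have "prod_list ns = n"
    using bij_betw_same_card[OF bij_idx] by (simp add: card_Zgroup)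
  then have "admissible_indexing n ns idx"
    using ns bij_idx by (simp add: admissible_indexing_def)
  moreover have "gram_Q idx phis (zadd ns q' r) (zadd ns q r) = gram_Q idx phis q' q"
    if q': "q' \<in> Zgroup ns" and q: "q \<in> Zgroup ns" and r: "r \<in> Zgroup ns" for q' q r
  proof -
    have shift: "phis (idx (zadd ns s r)) = f r *v phis (idx s)" if "s \<in> Zgroup ns" for s
      using that r hom[of r s]
      by (simp add: phif zadd_closed zadd_commute[of ns s r] matrix_vector_mul_assoc)
    have "unitary_mat (f r)"
      using unit idx_mem[OF r] Uidx[OF r] by metis
    then show ?thesis
      unfolding gram_Q_def shift[OF q'] shift[OF q] by (rule inner_c_unitary)
  qed
  then have "diag_by_fourier ns (gram_Q idx phis)"
    unfolding diag_by_fourier_iff_translation_invariant[OF ns] by blast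
  ultimately show ?thesis by blast
qed

theorem fourier_imp_geom_uniform:
  fixes phis :: "nat \<Rightarrow> complex^'m"
  assumes inj: "inj_on phis {1..n}"
    and adm: "admissible_indexing n ns idx" and diag: "diag_by_fourier ns (gram_Q idx phis)"
  shows "geom_uniform n phis"
proof -
  let ?Z = "Zgroup ns" and ?o = "replicate (length ns) 0" and ?F = "fourier_mat ns"
  have ns: "\<forall>t<length ns. 1 \<le> ns ! t" and bij: "bij_betw idx ?Z {1..n}"
    using adm by (auto simp: admissible_indexing_def)
  have o: "?o \<in> ?Z" using ns by (rule zero_in_Zgroup)
  note fin = finite_Zgroup[of ns]
  define v where "v q = phis (idx q)" for q
  define w where "w h = (\<Sum>q\<in>?Z. ?F q h *s v q)" for h
  obtain d where d: "\<And>q' q. q' \<in> ?Z \<Longrightarrow> q \<in> ?Z \<Longrightarrow>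
      inner_c (v q') (v q) = (\<Sum>h\<in>?Z. ?F q' h * d h * cnj (?F q h))"
    using diag unfolding diag_by_fourier_def gram_Q_def v_def by blast
  have delta: "(\<Sum>q\<in>?Z. ?F q g * cnj (?F q h)) = (if g = h then 1 else 0)"
    if "g \<in> ?Z" "h \<in> ?Z" for g h
    using fourier_mat_orthonormal[OF that] by (simp add: fourier_mat_commute)
  \<comment> \<open>Once the Gram entries are expanded through \<open>d\<close>, summing over
    \<open>q'\<close> first keeps only \<open>g = h\<close>.\<close>
  have wv: "inner_c (w h) (v q) = d h * cnj (?F q h)" if h: "h \<in> ?Z" and q: "q \<in> ?Z" for h q
  proof -
    have "inner_c (w h) (v q) = (\<Sum>q'\<in>?Z. \<Sum>g\<in>?Z. (d g * cnj (?F q g)) * (?F q' g * cnj (?F q' h)))"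
      unfolding w_def inner_c_sum_scale_left
      by (intro sum.cong refl) (simp add: d q sum_distrib_left mult_ac)
    also have "\<dots> = (\<Sum>g\<in>?Z. (d g * cnj (?F q g)) * (\<Sum>q'\<in>?Z. ?F q' g * cnj (?F q' h)))"
      by (subst sum.swap) (simp add: sum_distrib_left)
    also have "\<dots> = (\<Sum>g\<in>?Z. (d g * cnj (?F q g)) * (if g = h then 1 else 0))"
      by (intro sum.cong refl) (simp add: delta h)
    also have "\<dots> = d h * cnj (?F q h)"
      using h fin by (simp add: if_distrib cong: if_cong)
    finally show ?thesis .
  qed
  \<comment> \<open>The Gram matrix of \<open>w\<close> is diagonal with entries \<open>d\<close>.
    An entry \<open>d h = 0\<close> makes \<open>w h\<close> zero, the degenerate case that
    \<open>spectral_mat\<close> tolerates.\<close>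
  have orth: "inner_c (w h) (w h') = 0" if "h \<in> ?Z" "h' \<in> ?Z" "h \<noteq> h'" for h h'
  proof -
    have "inner_c (w h) (w h') = (\<Sum>q\<in>?Z. d h * (?F q h' * cnj (?F q h)))"
      unfolding w_def[of h'] inner_c_sum_scale_right
      by (intro sum.cong refl) (simp add: wv that mult_ac)
    also have "\<dots> = d h * (\<Sum>q\<in>?Z. ?F q h' * cnj (?F q h))"
      by (simp add: sum_distrib_left)
    finally show ?thesis using that by (simp add: delta)
  qed
  \<comment> \<open>Fourier inversion.\<close>
  have v_w: "v q = (\<Sum>h\<in>?Z. cnj (?F q h) *s w h)" if q: "q \<in> ?Z" for q
  proof -
    have "(\<Sum>h\<in>?Z. cnj (?F q h) *s w h) = (\<Sum>h\<in>?Z. \<Sum>q'\<in>?Z. (?F q' h * cnj (?F q h)) *s v q')"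
      unfolding w_def by (simp add: vec.scale_sum_right mult_ac)
    also have "\<dots> = (\<Sum>q'\<in>?Z. (\<Sum>h\<in>?Z. ?F q' h * cnj (?F q h)) *s v q')"
      by (subst sum.swap) (simp add: vec.scale_sum_left)
    also have "\<dots> = (\<Sum>q'\<in>?Z. if q' = q then v q' else 0)"
      by (intro sum.cong refl) (simp add: fourier_mat_orthonormal q)
    finally show ?thesis using q fin by simp
  qed
  \<comment> \<open>The eigenvalues are conjugated because \<open>v q\<close> has the conjugate
    coefficients \<open>cnj (?F q h)\<close> in terms of \<open>w\<close>; the product is the
    coefficient of \<open>v (zadd ns q r)\<close>.\<close>
  define W where "W r = spectral_mat ?Z w (\<lambda>h. cnj (fourier_kernel ns r h))" for r
  have W_v: "W r *v v q = v (zadd ns q r)" if r: "r \<in> ?Z" and q: "q \<in> ?Z" for r q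
  proof -
    have "W r *v v q = (\<Sum>h\<in>?Z. cnj (?F q h) *s (W r *v w h))"
      unfolding v_w[OF q] by (simp add: vec.linear_sum vec.linear_scale)
    also have "\<dots> = (\<Sum>h\<in>?Z. cnj (?F (zadd ns q r) h) *s w h)"
      using fin orth q r unfolding W_def
      by (intro sum.cong refl) (simp add: spectral_mat_eigenvector fourier_mat_zadd)
    finally show ?thesis using v_w zadd_closed q r by simp
  qed
  have W_mult: "W q ** W r = W (zadd ns q r)" if "q \<in> ?Z" "r \<in> ?Z" for q r
    unfolding W_def using fin orth that
    by (subst spectral_mat_mult) (auto intro!: spectral_mat_cong simp: fourier_kernel_zadd)
  have W_o: "W ?o = mat 1"
  proof -
    \<comment> \<open>Doubling zero makes this value idempotent, and its norm 1 excludes 0.\<close>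
    have "fourier_kernel ns ?o h = 1" if "h \<in> ?Z" for h
    proof -
      have "fourier_kernel ns ?o h * fourier_kernel ns ?o h = fourier_kernel ns ?o h"
        using fourier_kernel_zadd[OF o o that] zadd_zero[OF o] by simp
      then show ?thesis
        using norm_fourier_kernel[of ns ?o h] by auto
    qed
    then have "W ?o = spectral_mat ?Z w (\<lambda>_. 1)"
      unfolding W_def by (intro spectral_mat_cong) simp
    then show ?thesis by (simp add: spectral_mat_one)
  qed
  \<comment> \<open>The eigenvalues have modulus 1, so conjugating them inverts the matrix.\<close>
  have W_unitary: "unitary_mat (W r)" for r
    unfolding unitary_mat_def W_def adjoint_spectral_mat
    using fin orth spectral_mat_one[of ?Z w]
    by (simp add: spectral_mat_mult fourier_kernel_mult_cnj mult.commute[of "cnj _"])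
  \<comment> \<open>\<open>U i\<close> translates by the label of \<open>i\<close>; the generating
    vector is the one labelled zero.\<close>
  define U where "U i = W (inv_into ?Z idx i)" for i
  have inv_mem: "inv_into ?Z idx i \<in> ?Z" and idx_inv: "idx (inv_into ?Z idx i) = i"
    if "i \<in> {1..n}" for i
    using bij that by (auto simp: bij_betw_def inv_into_into f_inv_into_f)
  have img: "U ` {1..n} = W ` ?Z"
  proof -
    have "inv_into ?Z idx ` {1..n} = ?Z"
      using bij_betw_inv_into[OF bij] by (simp add: bij_betw_def)
    then show ?thesis unfolding U_def by (metis image_image)
  qed
  have phi: "phis i = U i *v v ?o" if "i \<in> {1..n}" for i
    using W_v[OF inv_mem[OF that] o] idx_inv[OF that] zadd_zero[OF inv_mem[OF that]]
    by (simp add: U_def v_def zadd_commute[of ns ?o])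
  have "abelian_matrix_group (U ` {1..n})"
    unfolding abelian_matrix_group_def img
  proof (intro conjI ballI)
    show "mat 1 \<in> W ` ?Z" using W_o o by (metis imageI)
  next
    fix A B assume "A \<in> W ` ?Z" "B \<in> W ` ?Z"
    then obtain q r where *: "q \<in> ?Z" "r \<in> ?Z" "A = W q" "B = W r" by blast
    then show "A ** B \<in> W ` ?Z" by (simp add: W_mult zadd_closed)
    show "A ** B = B ** A" using * by (simp add: W_mult zadd_commute)
  next
    fix A assume "A \<in> W ` ?Z"
    then obtain q where q: "q \<in> ?Z" "A = W q" by blast
    obtain r where r: "r \<in> ?Z" "zadd ns q r = ?o" using zadd_inverse[OF ns q(1)] by blast
    then have "A ** W r = mat 1" "W r ** A = mat 1"
      using q W_o by (simp_all add: W_mult zadd_commute[of ns r])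
    then show "\<exists>B\<in>W ` ?Z. A ** B = mat 1 \<and> B ** A = mat 1"
      using r by blast
  qed
  \<comment> \<open>If \<open>U i = U j\<close>, applying both to the generating vector gives
    \<open>phis i = phis j\<close>, hence \<open>i = j\<close>.\<close>
  moreover have "inj_on U {1..n}"
    using inj phi by (metis (no_types, lifting) inj_on_def)
  moreover have "\<forall>i\<in>{1..n}. unitary_mat (U i)"
    by (simp add: U_def W_unitary)
  ultimately show ?thesis
    unfolding geom_uniform_def using phi by blast
qed

section \<open>The rank of a Gram matrix\<close>

text \<open>A combination of the vectors \<open>v j\<close> that is orthogonal to every
  \<open>v i\<close> is orthogonal to itself, hence zero. So the Gram columns and the vectors
  satisfy the same linear relations.\<close>

lemma cols_independent_gram_iff:
  fixes v :: "'i \<Rightarrow> complex^'m"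
  assumes I: "finite I" and S: "S \<subseteq> I"
  shows "cols_independent I (\<lambda>i j. inner_c (v i) (v j)) S \<longleftrightarrow>
    (\<forall>c. (\<Sum>j\<in>S. c j *s v j) = 0 \<longrightarrow> (\<forall>j\<in>S. c j = 0))"
proof -
  have "(\<forall>i\<in>I. (\<Sum>j\<in>S. inner_c (v i) (v j) * c j) = 0) \<longleftrightarrow> (\<Sum>j\<in>S. c j *s v j) = 0" for c
  proof -
    let ?x = "\<Sum>j\<in>S. c j *s v j"
    have eq: "(\<Sum>j\<in>S. inner_c (v i) (v j) * c j) = inner_c (v i) ?x" for i
      by (simp add: inner_c_sum_scale_right mult.commute)
    have "?x = 0" if "\<forall>i\<in>I. inner_c (v i) ?x = 0"
    proof -
      have "inner_c ?x ?x = (\<Sum>j\<in>S. cnj (c j) * inner_c (v j) ?x)"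
        by (rule inner_c_sum_scale_left)
      also have "\<dots> = 0" using that S by (intro sum.neutral) auto
      finally show ?thesis by (simp add: inner_c_self_eq_0)
    qed
    moreover have "inner_c y 0 = 0" for y :: "complex^'m"
      by (simp add: inner_c_def)
    ultimately show ?thesis unfolding eq by metis
  qed
  then show ?thesis unfolding cols_independent_def by simp
qed

text \<open>Injectivity lets coefficients on indices and coefficients on vectors be exchanged, by
  \<open>inv_into\<close> one way and composition with \<open>v\<close> the other.\<close>

lemma vec_independent_image_iff:
  fixes v :: "'i \<Rightarrow> complex^'m"
  assumes S: "finite S" and inj: "inj_on v S"
  shows "vec.independent (v ` S) \<longleftrightarrow>
    (\<forall>c. (\<Sum>j\<in>S. c j *s v j) = 0 \<longrightarrow> (\<forall>j\<in>S. c j = 0))"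
proof
  assume L: "vec.independent (v ` S)"
  show "\<forall>c. (\<Sum>j\<in>S. c j *s v j) = 0 \<longrightarrow> (\<forall>j\<in>S. c j = 0)"
  proof (intro allI impI)
    fix c assume c: "(\<Sum>j\<in>S. c j *s v j) = 0"
    let ?u = "\<lambda>x. c (inv_into S v x)"
    have "(\<Sum>x\<in>v ` S. ?u x *s x) = (\<Sum>j\<in>S. c j *s v j)"
      using inj by (subst sum.reindex) auto
    then have "\<forall>x\<in>v ` S. ?u x = 0"
      using L c by (auto simp: vec.independent_explicit)
    then show "\<forall>j\<in>S. c j = 0" using inj by auto
  qed
next
  assume R: "\<forall>c. (\<Sum>j\<in>S. c j *s v j) = 0 \<longrightarrow> (\<forall>j\<in>S. c j = 0)"
  show "vec.independent (v ` S)"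
    unfolding vec.independent_explicit
  proof (intro conjI allI impI ballI)
    fix u x assume "(\<Sum>x\<in>v ` S. u x *s x) = 0" and x: "x \<in> v ` S"
    then have "(\<Sum>j\<in>S. u (v j) *s v j) = 0"
      using inj by (simp add: sum.reindex)
    then show "u x = 0" using R[rule_format, of "\<lambda>j. u (v j)"] x by auto
  qed (use S in simp)
qed

text \<open>Independent sets of Gram columns are the index sets of independent subfamilies, so their
  largest size is the dimension of the span.\<close>

lemma mat_rank_gram:
  fixes v :: "'i \<Rightarrow> complex^'m"
  assumes I: "finite I" and inj: "inj_on v I"
  shows "mat_rank I (\<lambda>i j. inner_c (v i) (v j)) = vec.dim (v ` I)"
  unfolding mat_rank_def
proof (rule Max_eqI)
  have iff: "cols_independent I (\<lambda>i j. inner_c (v i) (v j)) S \<longleftrightarrow> vec.independent (v ` S)"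
    if "S \<subseteq> I" for S
    using cols_independent_gram_iff[OF I that] vec_independent_image_iff[of S v]
      finite_subset[OF that I] inj_on_subset[OF inj that] by simp
  have "{card S | S. S \<subseteq> I \<and> cols_independent I (\<lambda>i j. inner_c (v i) (v j)) S} \<subseteq> card ` Pow I"
    by auto
  then show "finite {card S | S. S \<subseteq> I \<and> cols_independent I (\<lambda>i j. inner_c (v i) (v j)) S}"
    using I by (meson finite_Pow_iff finite_imageI finite_subset)
  show "y \<le> vec.dim (v ` I)"
    if "y \<in> {card S | S. S \<subseteq> I \<and> cols_independent I (\<lambda>i j. inner_c (v i) (v j)) S}" for y
  proof -
    from that obtain S where S: "y = card S" "S \<subseteq> I" "vec.independent (v ` S)"
      using iff by blast
    then have "card (v ` S) \<le> vec.dim (v ` I)"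
      by (intro vec.independent_card_le_dim) auto
    then show ?thesis using S inj_on_subset[OF inj S(2)] by (simp add: card_image)
  qed
  \<comment> \<open>A basis chosen among the vectors pulls back to an index set that attains the
    bound.\<close>
  obtain B where B: "B \<subseteq> v ` I" "vec.independent B" "card B = vec.dim (v ` I)"
    using vec.basis_exists[of "v ` I"] by metis
  obtain S where S: "S \<subseteq> I" "B = v ` S"
    using B(1) by (meson subset_imageE)
  then have "card S = vec.dim (v ` I)"
    using B inj_on_subset[OF inj S(1)] by (simp add: card_image)
  then show "vec.dim (v ` I) \<in> {card S | S. S \<subseteq> I \<and> cols_independent I (\<lambda>i j. inner_c (v i) (v j)) S}"
    using S B iff by (metis (mono_tags, lifting) mem_Collect_eq)
qed

text \<open>Since the vectors are distinct, indexed combinations are exactly the span of the set,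
  and a subspace of full dimension is the whole space.\<close>

lemma spans_Cm_iff_dim:
  fixes phis :: "nat \<Rightarrow> complex^'m"
  assumes inj: "inj_on phis {1..n}"
  shows "spans_Cm n phis \<longleftrightarrow> vec.dim (phis ` {1..n}) = CARD('m)"
proof -
  have "x \<in> vec.span (phis ` {1..n}) \<longleftrightarrow> (\<exists>c. x = (\<Sum>i\<in>{1..n}. c i *s phis i))" for x
  proof
    assume "x \<in> vec.span (phis ` {1..n})"
    then obtain u where "x = (\<Sum>y\<in>phis ` {1..n}. u y *s y)"
      by (auto simp: vec.span_finite)
    then have "x = (\<Sum>i\<in>{1..n}. u (phis i) *s phis i)"
      using inj by (simp add: sum.reindex)
    then show "\<exists>c. x = (\<Sum>i\<in>{1..n}. c i *s phis i)" by (rule exI[of _ "\<lambda>i. u (phis i)"])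
  next
    assume "\<exists>c. x = (\<Sum>i\<in>{1..n}. c i *s phis i)"
    then show "x \<in> vec.span (phis ` {1..n})"
      by (auto intro: vec.span_sum vec.span_scale vec.span_base)
  qed
  then have "spans_Cm n phis \<longleftrightarrow> vec.span (phis ` {1..n}) = UNIV"
    unfolding spans_Cm_def by blast
  also have "\<dots> \<longleftrightarrow> vec.dim (phis ` {1..n}) = CARD('m)"
    using vec.dim_eq_full[of "phis ` {1..n}"] by (metis vec.dim_UNIV vec.dim_eq_full vec.dim_span vec.span_UNIV vec_dim_card)
  finally show ?thesis .
qed

theorem theorem1:
  fixes phis :: "nat \<Rightarrow> complex^'m" and n :: nat
  assumes "inj_on phis {1..n}"
  shows "(geom_uniform n phis \<longleftrightarrow>
            (\<exists>ns idx. admissible_indexing n ns idx \<and>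
                        diag_by_fourier ns (gram_Q idx phis)))
       \<and> (\<forall>ns idx. admissible_indexing n ns idx \<and> diag_by_fourier ns (gram_Q idx phis) \<longrightarrow>
            (GU_frame n phis \<longleftrightarrow> mat_rank (Zgroup ns) (gram_Q idx phis) = CARD('m)))"
proof (intro conjI allI impI)
  show "geom_uniform n phis \<longleftrightarrow>
      (\<exists>ns idx. admissible_indexing n ns idx \<and> diag_by_fourier ns (gram_Q idx phis))"
    using geom_uniform_imp_fourier fourier_imp_geom_uniform[OF assms] by blast
  fix ns idx assume *: "admissible_indexing n ns idx \<and> diag_by_fourier ns (gram_Q idx phis)"
  then have bij: "bij_betw idx (Zgroup ns) {1..n}"
    by (simp add: admissible_indexing_def)
  have "inj_on (phis \<circ> idx) (Zgroup ns)"
    using bij assms by (metis bij_betw_def comp_inj_on)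
  then have "mat_rank (Zgroup ns) (\<lambda>q' q. inner_c ((phis \<circ> idx) q') ((phis \<circ> idx) q)) =
      vec.dim ((phis \<circ> idx) ` Zgroup ns)"
    by (rule mat_rank_gram[OF finite_Zgroup])
  moreover have "(\<lambda>q' q. inner_c ((phis \<circ> idx) q') ((phis \<circ> idx) q)) = gram_Q idx phis"
    by (simp add: gram_Q_def fun_eq_iff)
  moreover have "(phis \<circ> idx) ` Zgroup ns = phis ` {1..n}"
    using bij_betw_imp_surj_on[OF bij] by (simp only: image_comp[symmetric])
  \<comment> \<open>The diagonalization already gives geometric uniformity, so what remains is to
    match spanning with full rank.\<close>
  ultimately show "GU_frame n phis \<longleftrightarrow> mat_rank (Zgroup ns) (gram_Q idx phis) = CARD('m)"
    using * fourier_imp_geom_uniform[OF assms] spans_Cm_iff_dim[OF assms]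
    by (auto simp: GU_frame_def)
qed

end
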